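(* Let $S+1=\{n^2+1: n\in\mathbb{N}\}$ where $\mathbb{N}=\{1,2,3,\dots\}$, and for $N\in\mathbb{N}$ let $$D(S+1,N)=\max\{|A| : A\subseteq\{1,2,\dots,N\},\ (A-A)\cap(S+1)\subseteq\{0\}\}.$$ Then for all $N\in\mathbb{N}$, $$D(S+1,N)=\lceil N/3\rceil+1_E(N)+1_{\{9,24\}}(N),$$ where $E=\{2,3,5,6,8,9,10,11,12,17,18,20,21,23,24,25,26,27\}$ and $1_F$ denotes the indicator function of a set $F$.
   Context: For a set $A$ of integers, $A-A=\{a-b: a,b\in A\}$. Thus $D(S+1,N)$ is the maximum size of a subset of $\{1,\dots,N\}$ no two distinct elements of which differ by a number of the form $n^2+1$ with $n$ a positive integer. *)

theory Defs
  imports Complex_Main "HOL-Library.Indicator_Function"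
begin

definition difference_set :: "int set \<Rightarrow> int set" where
  "difference_set A = {a - b | a b. a \<in> A \<and> b \<in> A}"

definition shifted_squares :: "int set" where
  "shifted_squares = {int n ^ 2 + 1 | n :: nat. n \<ge> 1}"

(* The maximum is over a nonempty finite set: A = {} is admissible, and
   every cardinality is at most N. *)
definition D :: "int set \<Rightarrow> nat \<Rightarrow> nat" where
  "D X N = Max {card A | A. A \<subseteq> {1..int N} \<and> difference_set A \<inter> X \<subseteq> {0}}"

definition E :: "nat set" where
  "E = {2, 3, 5, 6, 8, 9, 10, 11, 12, 17, 18, 20, 21, 23, 24, 25, 26, 27}"

end

theory Submission
  imports Defs
begin

text \<open>
  Translation and restriction make \<open>D X\<close> subadditive. No \<open>n\<^sup>2 + 1\<close> is divisible by 3, so the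
  residue class of 1 gives the lower bound \<open>\<lceil>N/3\<rceil>\<close>; the exceptional values for \<open>N \<le> 27\<close> are attained
  by initial segments of \<open>{1, 2, 5, 8, 9} + {0, 15}\<close>. For the upper bound, \<open>D 15 = 5\<close> and
  subadditivity give \<open>D (N + 15) \<le> D N + 5\<close>, so everything reduces to \<open>N \<le> 42\<close>. These values
  are found one after another by a left-to-right search for a set with one element too many,
  where the bounds already known for shorter intervals keep the search tree small.
\<close>

section \<open>Translation invariance and subadditivity of \<open>D\<close>\<close>

definition avoids :: "int set \<Rightarrow> int set \<Rightarrow> bool" where
  "avoids X A \<longleftrightarrow> difference_set A \<inter> X \<subseteq> {0}"

lemma avoids_iff: "avoids X A \<longleftrightarrow> (\<forall>a\<in>A. \<forall>b\<in>A. a - b \<in> X \<longrightarrow> a = b)"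
proof -
  have "avoids X A \<longleftrightarrow> (\<forall>a\<in>A. \<forall>b\<in>A. a - b \<in> X \<longrightarrow> a - b = 0)"
    unfolding avoids_def difference_set_def by blast
  then show ?thesis by simp
qed

lemma avoids_subset: "avoids X A \<Longrightarrow> B \<subseteq> A \<Longrightarrow> avoids X B"
  unfolding avoids_iff by blast

lemma avoids_translate: "avoids X A \<Longrightarrow> avoids X ((\<lambda>a. a + t) ` A)"
  unfolding avoids_iff by auto

lemma finite_D_candidates: "finite {card A | A. A \<subseteq> {1..int N} \<and> avoids X A}"
proof -
  have "finite (card ` Pow {1..int N})" by simp
  then show ?thesis by (rule rev_finite_subset) auto
qed

lemma card_le_D:
  assumes "A \<subseteq> {1..int N}" "avoids X A"
  shows "card A \<le> D X N"
  unfolding D_def avoids_def [symmetric]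
  by (rule Max_ge [OF finite_D_candidates]) (use assms in auto)

lemma D_le_iff: "D X N \<le> c \<longleftrightarrow> (\<forall>A. A \<subseteq> {1..int N} \<longrightarrow> avoids X A \<longrightarrow> card A \<le> c)"
proof -
  have "{card A | A. A \<subseteq> {1..int N} \<and> avoids X A} \<noteq> {}"
    by (auto simp: avoids_iff intro!: exI [of _ "{}"])
  then show ?thesis
    unfolding D_def avoids_def [symmetric] by (subst Max_le_iff [OF finite_D_candidates]) auto
qed

text \<open>Avoidance depends on differences only, so the window can be moved to start at 1. This
  serves both subadditivity and the pruning of the search.\<close>

lemma card_interval_le_D:
  assumes "avoids X A"
  shows "card (A \<inter> {p..<p + int n}) \<le> D X n"
proof -
  let ?f = "\<lambda>a. a + (1 - p)"
  have "card (?f ` (A \<inter> {p..<p + int n})) \<le> D X n"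
    by (intro card_le_D avoids_translate avoids_subset [OF assms]) auto
  then show ?thesis by (simp add: card_image)
qed

lemma D_add_le: "D X (M + N) \<le> D X M + D X N"
  unfolding D_le_iff [of X "M + N"]
proof (intro allI impI)
  fix A assume A: "A \<subseteq> {1..int (M + N)}" "avoids X A"
  let ?p = "1 + int M"
  have "A = (A \<inter> {1..<?p}) \<union> (A \<inter> {?p..<?p + int N})"
    using A(1) by auto
  then have "card A \<le> card (A \<inter> {1..<?p}) + card (A \<inter> {?p..<?p + int N})"
    by (metis card_Un_le)
  also have "\<dots> \<le> D X M + D X N"
    using card_interval_le_D [OF A(2)] by (intro add_mono) auto
  finally show "card A \<le> D X M + D X N" .
qed

text \<open>
  \<open>extendable us xs p r\<close>: the set \<open>xs\<close>, lying to the left of \<open>p\<close>, may have an extension by \<open>r\<close>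
  elements of \<open>{p..<p + length us}\<close>. The head of \<open>us\<close> bounds the number of elements in the interval
  that remains after \<open>p\<close>. Nested \<open>if\<close>s instead of conjunctions keep the simplifier from
  unfolding branches that are cut off.
\<close>
primrec extendable :: "nat list \<Rightarrow> int list \<Rightarrow> int \<Rightarrow> nat \<Rightarrow> bool" where
  "extendable [] xs p r \<longleftrightarrow> r = 0"
| "extendable (u # us) xs p r \<longleftrightarrow>
    (if r \<le> u then extendable us xs (p + 1) r else False) \<or>
    (if r \<le> Suc u
     then if list_all (\<lambda>x. p - x \<notin> {2, 5, 10, 17, 26, 37}) xs
          then extendable us (p # xs) (p + 1) (r - 1) else False
     else False)"

text \<open>Entries run from the longest interval down, so dropping the head matches moving the
  search past one point.\<close>

primrec D_bounds :: "nat list \<Rightarrow> bool" where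
  "D_bounds [] \<longleftrightarrow> True"
| "D_bounds (u # us) \<longleftrightarrow> D shifted_squares (length us) \<le> u \<and> D_bounds us"

text \<open>Each entry is tested against the later ones only, so the bounds build up from the
  shortest interval without circularity.\<close>

primrec certified :: "nat list \<Rightarrow> bool" where
  "certified [] \<longleftrightarrow> True"
| "certified (u # us) \<longleftrightarrow> \<not> extendable us [] 1 (Suc u) \<and> certified us"

text \<open>This inclusion ensures that every pair rejected by the search is truly forbidden. Up to
  length 42 differences are at most 41, and the next value after 37 is 50.\<close>

lemma small_shifted_squares: "{2, 5, 10, 17, 26, 37} \<subseteq> shifted_squares"
proof -
  have *: "int n ^ 2 + 1 \<in> shifted_squares" if "n \<ge> 1" for n
    using that unfolding shifted_squares_def by blast
  show ?thesis
    using *[of 1] *[of 2] *[of 3] *[of 4] *[of 5] *[of 6] by simp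
qed

text \<open>The branch that takes \<open>p\<close> exactly when \<open>p \<in> A\<close> is never
  cut: the true remaining count \<open>card B\<close> is at most \<open>u\<close>, and
  \<open>A\<close> has no forbidden difference.\<close>

lemma extendable_complete:
  assumes "D_bounds us" "avoids shifted_squares A" "set xs \<subseteq> A"
    and "r \<le> card (A \<inter> {p..<p + int (length us)})"
  shows "extendable us xs p r"
  using assms
proof (induction us arbitrary: xs p r)
  case (Cons u us)
  define B where "B = A \<inter> {p + 1..<p + 1 + int (length us)}"
  have B: "card B \<le> u"
    using card_interval_le_D [OF Cons.prems(2), of "p + 1" "length us"] Cons.prems(1)
    by (auto simp: B_def)
  have IH: "extendable us ys (p + 1) s" if "set ys \<subseteq> A" "s \<le> card B" for ys s
    using Cons.IH [of ys s "p + 1"] Cons.prems that by (simp add: B_def)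
  show ?case
  proof (cases "p \<in> A")
    case True
    have eq: "A \<inter> {p..<p + int (length (u # us))} = insert p B"
      using True by (auto simp: B_def)
    have r: "r \<le> Suc (card B)"
      using Cons.prems(4) unfolding eq by (simp add: B_def)
    have "p - x \<notin> {2, 5, 10, 17, 26, 37}" if "x \<in> set xs" for x
    proof
      assume *: "p - x \<in> {2, 5, 10, 17, 26, 37}"
      then have "p = x"
        using small_shifted_squares Cons.prems(2,3) True that unfolding avoids_iff by blast
      with * show False by simp
    qed
    then have "list_all (\<lambda>x. p - x \<notin> {2, 5, 10, 17, 26, 37}) xs"
      unfolding list_all_iff by blast
    \<comment> \<open>For \<open>r = 0\<close> the truncated \<open>r - 1\<close> is still 0, hence
      at most \<open>card B\<close>.\<close>
    then show ?thesis
      using r B IH [of "p # xs" "r - 1"] True Cons.prems(3) by simp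
  next
    case False
    have "A \<inter> {p..<p + int (length (u # us))} = B"
    proof -
      have "x \<noteq> p" if "x \<in> A" for x using False that by blast
      then show ?thesis by (force simp: B_def)
    qed
    then show ?thesis
      using Cons.prems(3,4) B IH [of xs r] by simp
  qed
qed simp

lemma certified_imp_D_bounds: "certified us \<Longrightarrow> D_bounds us"
proof (induction us)
  case (Cons u us)
  have "card A \<le> u" if A: "A \<subseteq> {1..int (length us)}" "avoids shifted_squares A" for A
  proof (rule ccontr)
    assume "\<not> card A \<le> u"
    moreover have "A \<inter> {1..<1 + int (length us)} = A" using A(1) by auto
    ultimately have "extendable us [] 1 (Suc u)"
      using Cons A(2) by (intro extendable_complete [of _ A]) auto
    then show False using Cons.prems by simp
  qed
  then show ?case using Cons by (simp add: D_le_iff)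
qed simp

lemma D_bounds_imp_nth: "D_bounds us \<Longrightarrow> k < length us \<Longrightarrow> D shifted_squares k \<le> rev us ! k"
  by (induction us) (auto simp: nth_append less_Suc_eq)

lemma D_upto_42:
  assumes "k < 43"
  shows "D shifted_squares k \<le>
   [0, 1, 2, 2, 2, 3, 3, 3, 4, 5, 5, 5, 5, 5, 5, 5, 6, 7, 7, 7, 8, 8,
    8, 9, 10, 10, 10, 10, 10, 10, 10, 11, 11, 11, 12, 12, 12, 13, 13, 13, 14, 14, 14] ! k"
    (is "_ \<le> ?us ! k")
proof -
  \<comment> \<open>Evaluates 43 searches, one for each length from 0 to 42.\<close>
  have "certified (rev ?us)" by simp
  from D_bounds_imp_nth [OF certified_imp_D_bounds [OF this], of k] show ?thesis
    using assms by simp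
qed

lemmas D_upto_42_le = order_trans [OF D_upto_42]

section \<open>Upper bound outside \<open>E\<close>\<close>

lemma D_le_third:
  assumes "N \<notin> E"
  shows "D shifted_squares N \<le> (N + 2) div 3"
  using assms
proof (induction N rule: less_induct)
  case (less N)
  show ?case
  proof (cases "N < 43")
    case True
    have "\<forall>k\<in>set [2..<43]. k \<notin> E \<longrightarrow> D shifted_squares k \<le> (k + 2) div 3"
      by (simp add: E_def D_upto_42_le del: set_upt)
    moreover have "D shifted_squares 0 \<le> (0 + 2) div 3" "D shifted_squares 1 \<le> (1 + 2) div 3"
      by (rule D_upto_42_le; simp)+
    moreover have "N = 0 \<or> N = 1 \<or> N \<in> set [2..<43]"
      unfolding set_upt atLeastLessThan_iff using True by linarith
    ultimately show ?thesis using less.prems by blast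
  next
    case False
    \<comment> \<open>From \<open>N \<ge> 43\<close> follows \<open>M \<ge> 28\<close>, beyond the
      largest element 27 of \<open>E\<close>; hence a table up to 42.\<close>
    define M where "M = N - 15"
    have M: "N = M + 15" "M \<notin> E"
      using False by (auto simp: M_def E_def)
    have "D shifted_squares N \<le> D shifted_squares M + D shifted_squares 15"
      unfolding M by (rule D_add_le)
    also have "\<dots> \<le> (M + 2) div 3 + 5"
      using less.IH [of M] M by (intro add_mono) (simp_all add: D_upto_42_le)
    also have "\<dots> = (N + 2) div 3" unfolding M by simp
    finally show ?thesis .
  qed
qed

section \<open>Lower bounds from explicit sets\<close>

lemma not_3_dvd_shifted_square: "s \<in> shifted_squares \<Longrightarrow> \<not> 3 dvd s"
proof -
  assume "s \<in> shifted_squares"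
  then obtain n where s: "s = int n ^ 2 + 1" unfolding shifted_squares_def by blast
  have "int n mod 3 = 0 \<or> int n mod 3 = 1 \<or> int n mod 3 = 2" by presburger
  \<comment> \<open>Squares are 0 or 1 modulo 3.\<close>
  then have "(int n ^ 2 + 1) mod 3 \<noteq> 0"
    by (auto simp: mod_add_left_eq [of "int n ^ 2", symmetric] power_mod [of "int n", symmetric])
  then show "\<not> 3 dvd s" unfolding s by (simp add: dvd_eq_mod_eq_0)
qed

lemma D_ge_third: "(N + 2) div 3 \<le> D shifted_squares N"
proof -
  let ?f = "\<lambda>k. 3 * int k + 1"
  have "avoids shifted_squares (?f ` {..<(N + 2) div 3})"
    unfolding avoids_iff
  proof (intro ballI impI)
    fix a b assume "a \<in> ?f ` {..<(N + 2) div 3}" "b \<in> ?f ` {..<(N + 2) div 3}"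
      and d: "a - b \<in> shifted_squares"
    then obtain i j where "a - b = 3 * (int i - int j)" by fastforce
    then have "3 dvd a - b" by (metis dvd_triv_left)
    with not_3_dvd_shifted_square [OF d] show "a = b" by blast
  qed
  then have "card (?f ` {..<(N + 2) div 3}) \<le> D shifted_squares N"
    by (intro card_le_D) auto
  then show ?thesis by (simp add: card_image inj_on_def)
qed

text \<open>The threshold is \<open>5 ^ 2 + 1\<close>; it covers all differences in
  \<open>W\<close>, which are at most 23.\<close>

lemma shifted_squares_less_26: "s \<in> shifted_squares \<Longrightarrow> s < 26 \<Longrightarrow> s \<in> {2, 5, 10, 17}"
proof -
  assume "s \<in> shifted_squares" "s < 26"
  then obtain n where n: "s = int n ^ 2 + 1" "n \<ge> 1" "int n ^ 2 < 5 ^ 2"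
    unfolding shifted_squares_def by auto
  then have "n < 5" using power_less_imp_less_base [of "int n" 2 5] by simp
  with n(2) have "n = 1 \<or> n = 2 \<or> n = 3 \<or> n = 4" by arith
  then show ?thesis using n(1) by auto
qed

definition W :: "int set" where
  "W = {1, 2, 5, 8, 9, 16, 17, 20, 23, 24}"

lemma avoids_W: "avoids shifted_squares W"
  unfolding avoids_iff
proof (intro ballI impI)
  fix a b assume ab: "a \<in> W" "b \<in> W" "a - b \<in> shifted_squares"
  then have "a - b \<in> {2, 5, 10, 17}"
    by (intro shifted_squares_less_26) (auto simp: W_def)
  with ab(1,2) show "a = b" unfolding W_def by auto
qed

lemma card_W_le_D: "card (W \<inter> {1..int N}) \<le> D shifted_squares N"
  by (intro card_le_D avoids_subset [OF avoids_W]) auto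

lemma ceiling_third: "\<lceil>real N / 3\<rceil> = int ((N + 2) div 3)"
proof (rule ceiling_unique)
  have "(N + 2) div 3 * 3 \<le> N + 2" "N \<le> (N + 2) div 3 * 3" by presburger+
  then show "real_of_int (int ((N + 2) div 3)) - 1 < real N / 3"
    and "real N / 3 \<le> real_of_int (int ((N + 2) div 3))"
    by linarith+
qed

theorem theorem1p3:
  fixes N :: nat
  assumes "N \<ge> 1"
  shows "int (D shifted_squares N)
    = \<lceil>real N / 3\<rceil> + indicator E N + indicator {9, 24} N"
proof (cases "N \<in> E")
  case True
  \<comment> \<open>On \<open>E\<close> the table and the counts of \<open>W\<close> meet; the
    excess is 2 exactly at 9 and 24, where \<open>W\<close> has 5 and 10 elements.\<close>
  have "\<forall>k\<in>E. D shifted_squares k \<le> (k + 2) div 3 + 1 + indicator {9, 24} k"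
    by (simp add: E_def D_upto_42_le)
  moreover have "\<forall>k\<in>E. card (W \<inter> {1..int k}) = (k + 2) div 3 + 1 + indicator {9, 24} k"
    by (simp add: E_def W_def)
  ultimately have "D shifted_squares N = (N + 2) div 3 + 1 + indicator {9, 24} N"
    using True card_W_le_D [of N] by (metis order_antisym)
  with True show ?thesis by (simp add: ceiling_third indicator_def)
next
  case False
  then have "D shifted_squares N = (N + 2) div 3"
    by (intro antisym D_le_third D_ge_third)
  with False show ?thesis by (auto simp: ceiling_third indicator_def E_def)
qed

end
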